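(* For every $n\ge 0$ and $k\ge 0$, the number of partitions $\lambda$ of $n$ with pairing index $T(\lambda)=k$ equals the number of partitions of $n$ into exactly $k$ parts.
   Context: For an integer partition $\lambda$, pair equal parts of $\lambda$ as far as possible: for each part size occurring with odd multiplicity exactly one copy remains unpaired, and a part size of even multiplicity is completely paired. Let $r(\lambda)$ be the largest part size that participates in at least one pair (i.e. the largest part size of multiplicity at least $2$), with $r(\lambda)=0$ if $\lambda$ has distinct parts. Write the unpaired parts (the part sizes of odd multiplicity, each once) in decreasing order $u_1>u_2>\cdots>u_s$ and let $s(\lambda)=u_1-u_2+u_3-u_4+\cdots$ (so $s(\lambda)=0$ if there are no unpaired parts). The pairing index of $\lambda$ is $T(\lambda)=r(\lambda)+s(\lambda)$. *)

theory Defs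
  imports "HOL-Library.Multiset"
begin

text \<open>An integer partition is the finite multiset of its parts, all of them positive.\<close>

definition partitions :: "nat \<Rightarrow> nat multiset set" where
  "partitions n = {p. 0 \<notin># p \<and> sum_mset p = n}"

text \<open>In particular, \<^const>\<open>card\<close> of a set of partitions of \<open>n\<close> is a genuine count.\<close>

lemma finite_partitions: "finite (partitions n)"
proof (rule finite_subset)
  have size_le: "size p \<le> sum_mset p" if "0 \<notin># p" for p :: "nat multiset"
    using that by (induction p) auto
  have "p \<in> mset ` {xs. set xs \<subseteq> {..n} \<and> length xs \<le> n}" if "p \<in> partitions n" for p
  proof -
    obtain xs where xs: "p = mset xs"
      by (metis ex_mset)
    have "set xs \<subseteq> {..n}"
      using that member_le_sum_list[of _ xs] by (auto simp: partitions_def xs sum_mset_sum_list)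
    moreover have "length xs \<le> n"
      using that size_le[of p] by (simp add: partitions_def xs)
    ultimately show ?thesis
      using xs by blast
  qed
  then show "partitions n \<subseteq> mset ` {xs. set xs \<subseteq> {..n} \<and> length xs \<le> n}"
    by blast
  show "finite (mset ` {xs. set xs \<subseteq> {..n} \<and> length xs \<le> n})"
    by (intro finite_imageI finite_lists_length_le) simp
qed

text \<open>The set under \<^const>\<open>Max\<close> is finite and nonempty; the inserted 0 is the value for a
  partition into distinct parts.\<close>

definition largest_paired :: "nat multiset \<Rightarrow> nat" where
  "largest_paired p = Max (insert 0 {i. 2 \<le> count p i})"

definition unpaired_parts :: "nat multiset \<Rightarrow> nat list" where
  "unpaired_parts p = rev (sorted_list_of_set {i. odd (count p i)})"

text \<open>Computed in \<^typ>\<open>int\<close>, as subtraction on \<^typ>\<open>nat\<close> truncates. List positions start at 0,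
  so the largest unpaired part has sign \<open>+\<close>.\<close>

definition unpaired_alt_sum :: "nat multiset \<Rightarrow> int" where
  "unpaired_alt_sum p =
     (\<Sum>i<length (unpaired_parts p). (-1) ^ i * int (unpaired_parts p ! i))"

definition pairing_index :: "nat multiset \<Rightarrow> int" where
  "pairing_index p = int (largest_paired p) + unpaired_alt_sum p"

end

(*
  Write p = q + d + d with q the unpaired parts and d one copy of each pair. Then T p is the
  largest part of d plus the alternating sum of q. Conjugation turns the largest part of d into
  a number of parts, and the theorem follows by comparing with p = q + 2 e, where q consists of
  the odd parts and e of the halved even parts, once one knows that partitions into distinct
  parts with alternating sum k are equinumerous with partitions into k odd parts. For that,
  paired parts do not affect the alternating sum, so both splittings apply to the partitions
  with alternating sum k, which by conjugation correspond to the partitions with k odd parts;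
  the desired equality then follows by cancellation, by induction on n.
*)

theory Submission
  imports Defs "HOL-Library.FuncSet"
begin

section \<open>Conjugation\<close>

text \<open>With \<open>i\<close> counted from 0, this is the length of column \<open>i\<close> of
  the Young diagram.\<close>

definition parts_above :: "nat multiset \<Rightarrow> nat \<Rightarrow> nat" where
  "parts_above p i = size (filter_mset (\<lambda>x. i < x) p)"

definition conj_partition :: "nat multiset \<Rightarrow> nat multiset" where
  "conj_partition p = image_mset (parts_above p) (mset_set {i. 0 < parts_above p i})"

lemma parts_above_union [simp]: "parts_above (p + q) i = parts_above p i + parts_above q i"
  by (simp add: parts_above_def)

lemma parts_above_antimono: "i \<le> j \<Longrightarrow> parts_above p j \<le> parts_above p i"
  by (induction p) (auto simp: parts_above_def)

lemma parts_above_pos_iff: "0 < parts_above p i \<longleftrightarrow> i < Max (insert 0 (set_mset p))"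
proof -
  have "0 < parts_above p i \<longleftrightarrow> (\<exists>x\<in>#p. i < x)"
    by (induction p) (auto simp: parts_above_def)
  then show ?thesis by (auto simp: Max_gr_iff)
qed

lemma parts_above_pos_set: "{i. 0 < parts_above p i} = {..<Max (insert 0 (set_mset p))}"
  by (auto simp: parts_above_pos_iff)

lemma finite_parts_above: "finite {i. k < parts_above p i}"
  by (rule finite_subset[of _ "{i. 0 < parts_above p i}"])
    (auto, simp add: parts_above_pos_set)

text \<open>Column lengths weakly decrease, so the columns longer than \<open>k\<close> form an
  initial segment of the naturals. This symmetry between rows and columns makes conjugation an
  involution.\<close>

lemma card_parts_above_greater:
  "j < card {i. k < parts_above p i} \<longleftrightarrow> k < parts_above p j"
proof -
  let ?S = "{i. k < parts_above p i}"
  show ?thesis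
  proof
    assume "j < card ?S"
    then have "\<not> ?S \<subseteq> {..<j}"
      using card_mono[of "{..<j}" ?S] by auto
    then obtain i where "k < parts_above p i" "j \<le> i"
      by fastforce
    then show "k < parts_above p j"
      using parts_above_antimono[of j i p] by linarith
  next
    assume "k < parts_above p j"
    then have "{..j} \<subseteq> ?S"
      using parts_above_antimono[of _ j p] by (auto intro: order.strict_trans2)
    then show "j < card ?S"
      using card_mono[OF finite_parts_above, of "{..j}" k p] by simp
  qed
qed

lemma parts_above_conj: "parts_above (conj_partition p) j = card {i. j < parts_above p i}"
proof -
  have "{i \<in> {i. 0 < parts_above p i}. j < parts_above p i} = {i. j < parts_above p i}"
    by auto
  then show ?thesis
    unfolding conj_partition_def
    by (subst parts_above_def) (simp add: filter_mset_image_mset finite_parts_above)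
qed

lemma zero_notin_conj: "0 \<notin># conj_partition p"
  by (auto simp: conj_partition_def finite_parts_above)

text \<open>The multiplicity of \<open>Suc i\<close> is the drop from column \<open>i\<close> to
  column \<open>Suc i\<close>; the multiplicity of 0 is invisible to the columns and is fixed by the
  hypotheses.\<close>

lemma parts_above_inject:
  assumes "0 \<notin># p" "0 \<notin># q" and eq: "parts_above p = parts_above q"
  shows "p = q"
proof (rule multiset_eqI)
  have rec: "parts_above r i = count r (Suc i) + parts_above r (Suc i)" for r i
    by (induction r) (auto simp: parts_above_def)
  fix x
  show "count p x = count q x"
  proof (cases x)
    case 0
    then show ?thesis using assms by (metis not_in_iff)
  next
    case (Suc i)
    then show ?thesis using rec[of p i] rec[of q i] eq by simp
  qed
qed

lemma conj_conj_partition: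
  assumes "0 \<notin># p"
  shows "conj_partition (conj_partition p) = p"
  by (rule parts_above_inject)
    (auto simp: assms zero_notin_conj parts_above_conj card_parts_above_greater fun_eq_iff)

lemma sum_conj_partition: "sum_mset (conj_partition p) = sum_mset p"
proof -
  \<comment> \<open>Counts the cells by columns. With \<open>m\<close> fixed, a new part
    \<open>x\<close> adds one cell to each of the first \<open>x\<close> columns, and columns beyond
    the largest part contribute 0.\<close>
  have "sum (parts_above p) {..<m} = sum_mset p" if "\<forall>x\<in>#p. x \<le> m" for m
    using that
  proof (induction p)
    case (add x p)
    have "parts_above (add_mset x p) i = (if i < x then 1 else 0) + parts_above p i" for i
      by (simp add: parts_above_def)
    moreover have "{..<m} \<inter> {i. i < x} = {..<x}"
      using add.prems by auto
    ultimately show ?case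
      using add by (simp add: sum.distrib sum.If_cases)
  qed (simp add: parts_above_def)
  then show ?thesis
    by (simp add: conj_partition_def parts_above_pos_set sum_unfold_sum_mset[symmetric])
qed

lemma size_conj_partition: "size (conj_partition p) = Max (insert 0 (set_mset p))"
  by (simp add: conj_partition_def parts_above_pos_set)

lemma conj_partition_mem: "p \<in> partitions n \<Longrightarrow> conj_partition p \<in> partitions n"
  by (simp add: partitions_def zero_notin_conj sum_conj_partition)

section \<open>The alternating sum\<close>

text \<open>In a column of the Young diagram the alternating row signs add up to 1 or 0 according to
  the parity of its length.\<close>

definition alt_sum :: "nat multiset \<Rightarrow> nat" where
  "alt_sum p = card {i. odd (parts_above p i)}"

lemma finite_odd_parts_above: "finite {i. odd (parts_above p i)}"
  by (rule finite_subset[OF _ finite_parts_above[of 0 p]]) (auto intro: odd_pos)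

lemma size_odd_conj_partition: "size (filter_mset odd (conj_partition p)) = alt_sum p"
proof -
  have "{i \<in> {i. 0 < parts_above p i}. odd (parts_above p i)} = {i. odd (parts_above p i)}"
    by (auto intro: odd_pos)
  then show ?thesis
    by (simp add: conj_partition_def alt_sum_def filter_mset_image_mset
        finite_parts_above)
qed

text \<open>Adding \<open>d\<close> twice lengthens every column by an even amount.\<close>

lemma alt_sum_paired: "alt_sum (q + d + d) = alt_sum q"
proof -
  have "odd (parts_above (q + d + d) i) \<longleftrightarrow> odd (parts_above q i)" for i
    unfolding parts_above_union by presburger
  then show ?thesis by (simp add: alt_sum_def)
qed

text \<open>Putting a new largest entry \<open>x\<close> in front flips the parity at each
  \<open>i < x\<close>, while nothing exceeds any \<open>i \<ge> x\<close>. So the counted set is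
  replaced by its complement in \<open>{..<x}\<close>, just as the alternating sum \<open>a\<close>
  of the tail becomes \<open>x - a\<close>.\<close>

lemma alternating_sum_decreasing_list:
  fixes xs :: "nat list"
  assumes "sorted_wrt (>) xs"
  shows "(\<Sum>i<length xs. (-1) ^ i * int (xs ! i)) = int (card {i. odd (card {x \<in> set xs. i < x})})"
  using assms
proof (induction xs)
  case (Cons x xs)
  let ?S = "{i. odd (card {y \<in> set xs. i < y})}"
  have sub: "?S \<subseteq> {..<x}"
  proof
    fix i assume "i \<in> ?S"
    then have "{y \<in> set xs. i < y} \<noteq> {}" by (intro odd_card_imp_not_empty) simp
    then show "i \<in> {..<x}" using Cons.prems by fastforce
  qed
  have insert: "{y \<in> set (x # xs). i < y} =
      (if i < x then insert x {y \<in> set xs. i < y} else {y \<in> set xs. i < y})" for i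
    by auto
  have notin: "x \<notin> set xs" using Cons.prems by auto
  have "{i. odd (card {y \<in> set (x # xs). i < y})} = {..<x} - ?S"
    unfolding insert using sub by (auto simp: notin split: if_splits)
  then have "int (card {i. odd (card {y \<in> set (x # xs). i < y})}) = int x - int (card ?S)"
    using sub card_mono[OF _ sub] by (simp add: card_Diff_subset finite_subset of_nat_diff)
  then show ?case
    using Cons
    by (simp add: sum.lessThan_Suc_shift sum_negf del: set_simps sum.lessThan_Suc)
qed simp

lemma odd_count_mem: "odd (count p x) \<Longrightarrow> x \<in># p"
  by (metis even_zero not_in_iff)

text \<open>Modulo 2, only part sizes of odd multiplicity contribute to a column, each of them
  once.\<close>

lemma odd_parts_above_iff:
  "odd (parts_above p i) \<longleftrightarrow> odd (card {x. odd (count p x) \<and> i < x})"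
proof -
  have "parts_above p i = (\<Sum>x\<in>{x \<in> set_mset p. i < x}. count p x)"
    by (auto simp: parts_above_def size_multiset_overloaded_eq intro!: sum.cong)
  moreover have "{x \<in> {x \<in> set_mset p. i < x}. odd (count p x)} = {x. odd (count p x) \<and> i < x}"
    by (auto intro: odd_count_mem)
  ultimately show ?thesis
    by (simp add: even_sum_iff)
qed

lemma unpaired_alt_sum_eq: "unpaired_alt_sum p = int (alt_sum p)"
proof -
  let ?U = "{i. odd (count p i)}"
  have fin: "finite ?U"
    by (rule finite_subset[of _ "set_mset p"]) (auto intro: odd_count_mem)
  have "sorted_wrt (>) (unpaired_parts p)"
    by (simp add: unpaired_parts_def sorted_wrt_rev)
  moreover have "set (unpaired_parts p) = ?U"
    using fin by (simp add: unpaired_parts_def)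
  ultimately show ?thesis
    using alternating_sum_decreasing_list[of "unpaired_parts p"]
    by (simp add: unpaired_alt_sum_def alt_sum_def odd_parts_above_iff)
qed

section \<open>Splitting partitions\<close>

text \<open>The range of \<open>d\<close> in both splittings: one copy of each pair, or the halved
  even parts. Either way \<open>d\<close> accounts for \<open>2 * sum_mset d\<close> of the total
  \<open>n\<close>.\<close>

definition paired_halves :: "nat \<Rightarrow> nat multiset set" where
  "paired_halves n = {d. 0 \<notin># d \<and> 2 * sum_mset d \<le> n}"

definition distinct_parts :: "nat multiset \<Rightarrow> bool" where
  "distinct_parts q \<longleftrightarrow> (\<forall>x. count q x \<le> 1)"

definition odd_parts :: "nat multiset \<Rightarrow> bool" where
  "odd_parts q \<longleftrightarrow> (\<forall>x\<in>#q. odd x)"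

lemma finite_paired_halves: "finite (paired_halves n)"
proof (rule finite_subset)
  show "paired_halves n \<subseteq> (\<Union>m\<le>n. partitions m)"
    by (auto simp: paired_halves_def partitions_def)
qed (simp add: finite_partitions)

text \<open>Common to both splittings: \<open>J\<close> glues \<open>q\<close> and \<open>d\<close>
  together, and partitions are counted separately for each \<open>d\<close>. The bounds
  \<open>2 * sum_mset d \<le> n\<close> and \<open>g d \<le> k\<close> keep the natural-number
  subtractions exact.\<close>

lemma card_split:
  fixes f g h :: "nat multiset \<Rightarrow> nat"
  assumes inj: "\<And>q d q' d'. Q q \<Longrightarrow> Q q' \<Longrightarrow> J q d = J q' d' \<Longrightarrow> q = q' \<and> d = d'"
    and surj: "\<And>p. \<exists>q d. Q q \<and> p = J q d"
    and zero: "\<And>q d. 0 \<in># J q d \<longleftrightarrow> 0 \<in># q \<or> 0 \<in># d"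
    and sum: "\<And>q d. sum_mset (J q d) = sum_mset q + 2 * sum_mset d"
    and stat: "\<And>q d. Q q \<Longrightarrow> h (J q d) = f q + g d"
  shows "card {p \<in> partitions n. h p = k} =
    (\<Sum>d\<in>{d \<in> paired_halves n. g d \<le> k}.
      card {q \<in> partitions (n - 2 * sum_mset d). Q q \<and> f q = k - g d})"
proof -
  let ?I = "{d \<in> paired_halves n. g d \<le> k}"
  let ?F = "\<lambda>d. {q \<in> partitions (n - 2 * sum_mset d). Q q \<and> f q = k - g d}"
  have "bij_betw (\<lambda>(d, q). J q d) (Sigma ?I ?F) {p \<in> partitions n. h p = k}"
    unfolding bij_betw_def
  proof
    show "inj_on (\<lambda>(d, q). J q d) (Sigma ?I ?F)"
      unfolding inj_on_def using inj by (auto; blast)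
    show "(\<lambda>(d, q). J q d) ` Sigma ?I ?F = {p \<in> partitions n. h p = k}"
    proof (intro equalityI subsetI)
      fix p assume "p \<in> (\<lambda>(d, q). J q d) ` Sigma ?I ?F"
      then show "p \<in> {p \<in> partitions n. h p = k}"
        by (auto simp: partitions_def paired_halves_def zero sum stat)
    next
      fix p assume p: "p \<in> {p \<in> partitions n. h p = k}"
      obtain q d where qd: "Q q" "p = J q d" using surj by blast
      then have "(d, q) \<in> Sigma ?I ?F"
        using p by (auto simp: partitions_def paired_halves_def zero sum stat)
      then show "p \<in> (\<lambda>(d, q). J q d) ` Sigma ?I ?F"
        by (rule rev_image_eqI) (simp add: qd)
    qed
  qed
  then have "card {p \<in> partitions n. h p = k} = card (Sigma ?I ?F)"
    by (simp add: bij_betw_same_card)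
  also have "\<dots> = (\<Sum>d\<in>?I. card (?F d))"
    by (rule card_SigmaI) (auto simp: finite_paired_halves finite_partitions)
  finally show ?thesis .
qed

text \<open>The multiplicities in \<open>q\<close> and \<open>d\<close> are the remainder and
  quotient by 2 of the multiplicity in the whole.\<close>

lemma pair_split_unique:
  assumes "distinct_parts q" "distinct_parts q'" "q + d + d = q' + d' + d'"
  shows "q = q' \<and> d = d'"
proof -
  have "count q x = count q' x \<and> count d x = count d' x" for x
  proof -
    have "count q x \<le> 1" "count q' x \<le> 1"
      using assms by (auto simp: distinct_parts_def)
    moreover have "count q x + count d x + count d x = count q' x + count d' x + count d' x"
      by (metis assms(3) count_union)
    ultimately show ?thesis by presburger
  qed
  then show ?thesis by (simp add: multiset_eq_iff)
qed

lemma pair_split_exists: "\<exists>q d. distinct_parts q \<and> p = q + d + d"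
proof (intro exI conjI)
  let ?q = "\<Sum>x\<in>set_mset p. replicate_mset (count p x mod 2) x"
  let ?d = "\<Sum>x\<in>set_mset p. replicate_mset (count p x div 2) x"
  have count: "count (\<Sum>x\<in>set_mset p. replicate_mset (f x) x) y = (if y \<in># p then f y else 0)"
    for f y
    by (simp add: count_sum)
  show "distinct_parts ?q"
    by (auto simp: distinct_parts_def count)
  show "p = ?q + ?d + ?d"
  proof (rule multiset_eqI)
    fix y
    show "count p y = count (?q + ?d + ?d) y"
      by (simp add: count not_in_iff) presburger
  qed
qed

text \<open>The odd parts recover \<open>q\<close>, the even parts recover the doubled
  \<open>d\<close>, and doubling is injective.\<close>

lemma parity_split_unique:
  assumes "odd_parts q" "odd_parts q'"
    and eq: "q + image_mset ((*) 2) d = q' + image_mset ((*) 2) d'"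
  shows "q = q' \<and> d = d'"
proof -
  have odd: "filter_mset odd (r + image_mset ((*) 2) e) = r"
    and even: "filter_mset even (r + image_mset ((*) 2) e) = image_mset ((*) 2) e"
    if "odd_parts r" for r and e :: "nat multiset"
    using that by (auto simp: odd_parts_def filter_mset_image_mset filter_mset_eq_conv)
  have "q = q'" using odd assms by metis
  moreover have "image_mset ((*) 2) d = image_mset ((*) 2) d'"
    using even assms by metis
  then have "d = d'"
    by (rule multiset.inj_map_strong[rotated]) simp
  ultimately show ?thesis ..
qed

lemma parity_split_exists: "\<exists>q d. odd_parts q \<and> p = q + image_mset ((*) 2) d"
proof (intro exI conjI)
  show "odd_parts (filter_mset odd p)"
    by (simp add: odd_parts_def)
  have "image_mset ((*) 2) (image_mset (\<lambda>x. x div 2) (filter_mset even p)) = filter_mset even p"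
    by (induction p) auto
  then show "p = filter_mset odd p +
      image_mset ((*) 2) (image_mset (\<lambda>x. x div 2) (filter_mset even p))"
    by (metis multiset_partition union_commute)
qed

lemma sum_mset_double: "sum_mset (image_mset ((*) 2) d) = 2 * sum_mset (d :: nat multiset)"
  by (induction d) auto

lemma card_pair_split:
  fixes f g h :: "nat multiset \<Rightarrow> nat"
  assumes "\<And>q d. distinct_parts q \<Longrightarrow> h (q + d + d) = f q + g d"
  shows "card {p \<in> partitions n. h p = k} =
    (\<Sum>d\<in>{d \<in> paired_halves n. g d \<le> k}.
      card {q \<in> partitions (n - 2 * sum_mset d). distinct_parts q \<and> f q = k - g d})"
proof (rule card_split[where J = "\<lambda>q d. q + d + d"])
  show "\<exists>q d. distinct_parts q \<and> p = q + d + d" for p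
    by (rule pair_split_exists)
  show "q = q' \<and> d = d'"
    if "distinct_parts q" "distinct_parts q'" "q + d + d = q' + d' + d'" for q d q' d'
    using that by (rule pair_split_unique)
qed (simp_all add: assms)

lemma card_parity_split:
  fixes f g h :: "nat multiset \<Rightarrow> nat"
  assumes "\<And>q d. odd_parts q \<Longrightarrow> h (q + image_mset ((*) 2) d) = f q + g d"
  shows "card {p \<in> partitions n. h p = k} =
    (\<Sum>d\<in>{d \<in> paired_halves n. g d \<le> k}.
      card {q \<in> partitions (n - 2 * sum_mset d). odd_parts q \<and> f q = k - g d})"
proof (rule card_split[where J = "\<lambda>q d. q + image_mset ((*) 2) d"])
  show "\<exists>q d. odd_parts q \<and> p = q + image_mset ((*) 2) d" for p
    by (rule parity_split_exists)
  show "0 \<in># q + image_mset ((*) 2) d \<longleftrightarrow> 0 \<in># q \<or> 0 \<in># d" for q d :: "nat multiset"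
    by auto
  show "q = q' \<and> d = d'"
    if "odd_parts q" "odd_parts q'" "q + image_mset ((*) 2) d = q' + image_mset ((*) 2) d'"
    for q d q' d'
    using that by (rule parity_split_unique)
qed (simp_all add: assms sum_mset_double)

section \<open>Equinumerosity\<close>

text \<open>Conjugation exchanges columns of odd length with odd parts.\<close>

lemma card_alt_sum_eq_odd:
  "card {p \<in> partitions n. alt_sum p = k} =
    card {p \<in> partitions n. size (filter_mset odd p) = k}"
proof (rule bij_betw_same_card[of conj_partition], rule bij_betwI[where g = conj_partition])
  have *: "alt_sum (conj_partition p) = size (filter_mset odd p)" if "p \<in> partitions n" for p
    using that size_odd_conj_partition[of "conj_partition p"]
    by (simp add: conj_conj_partition partitions_def)
  show "conj_partition \<in> {p \<in> partitions n. alt_sum p = k} \<rightarrow>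
      {p \<in> partitions n. size (filter_mset odd p) = k}"
    by (auto simp: conj_partition_mem size_odd_conj_partition)
  show "conj_partition \<in> {p \<in> partitions n. size (filter_mset odd p) = k} \<rightarrow>
      {p \<in> partitions n. alt_sum p = k}"
    by (auto simp: conj_partition_mem *)
qed (auto simp: partitions_def conj_conj_partition)

lemma card_distinct_eq_odd:
  "card {q \<in> partitions n. distinct_parts q \<and> alt_sum q = k} =
    card {q \<in> partitions n. odd_parts q \<and> size q = k}"
proof (induction n rule: less_induct)
  case (less n)
  let ?D = "\<lambda>d. card {q \<in> partitions (n - 2 * sum_mset d). distinct_parts q \<and> alt_sum q = k}"
  let ?O = "\<lambda>d. card {q \<in> partitions (n - 2 * sum_mset d). odd_parts q \<and> size q = k}"
  \<comment> \<open>Here \<open>d\<close> does not affect the statistic, so \<open>g\<close> is 0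
    and the same \<open>k\<close> occurs in every summand.\<close>
  have "(\<Sum>d\<in>paired_halves n. ?D d) = card {p \<in> partitions n. alt_sum p = k}"
    using card_pair_split[of alt_sum alt_sum "\<lambda>_. 0" n k] by (simp add: alt_sum_paired)
  also have "\<dots> = card {p \<in> partitions n. size (filter_mset odd p) = k}"
    by (rule card_alt_sum_eq_odd)
  also have "\<dots> = (\<Sum>d\<in>paired_halves n. ?O d)"
  proof -
    have "size (filter_mset odd (q + image_mset ((*) 2) d)) = size q + 0"
      if "odd_parts q" for q and d :: "nat multiset"
    proof -
      have "filter_mset odd q = q"
        using that by (simp add: odd_parts_def filter_mset_eq_conv)
      then show ?thesis by (simp add: filter_mset_image_mset)
    qed
    then show ?thesis
      using card_parity_split[of "\<lambda>p. size (filter_mset odd p)" size "\<lambda>_. 0" n k] by simp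
  qed
  finally have eq: "(\<Sum>d\<in>paired_halves n. ?D d) = (\<Sum>d\<in>paired_halves n. ?O d)" .
  \<comment> \<open>The summand for the empty \<open>d\<close> is the claim for \<open>n\<close>
    itself; any other \<open>d\<close> has positive sum, so its summand falls under the induction
    hypothesis and cancels.\<close>
  have mem: "{#} \<in> paired_halves n"
    by (simp add: paired_halves_def)
  have "?D d = ?O d" if "d \<in> paired_halves n - {{#}}" for d
  proof (rule less.IH)
    have "sum_mset d > 0" "2 * sum_mset d \<le> n"
      using that by (auto simp: paired_halves_def sum_mset_0_iff intro!: gr0I)
        (metis multiset_nonemptyE)
    then show "n - 2 * sum_mset d < n" by linarith
  qed
  then have "(\<Sum>d\<in>paired_halves n - {{#}}. ?D d) = (\<Sum>d\<in>paired_halves n - {{#}}. ?O d)"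
    by (rule sum.cong[OF refl])
  then have "?D {#} = ?O {#}"
    using eq by (simp add: sum.remove[OF finite_paired_halves mem])
  then show ?case by simp
qed

text \<open>Since \<open>q\<close> contributes at most one copy of a size, the repeated sizes are
  exactly the parts of \<open>d\<close>. The largest of them is the number of columns of
  \<open>d\<close>, and both sides are 0 for empty \<open>d\<close>.\<close>

lemma largest_paired_eq:
  assumes "distinct_parts q"
  shows "largest_paired (q + d + d) = size (conj_partition d)"
proof -
  have "2 \<le> count (q + d + d) i \<longleftrightarrow> i \<in># d" for i
  proof -
    have "count q i \<le> 1" using assms by (simp add: distinct_parts_def)
    then show ?thesis by (auto simp: count_greater_zero_iff[symmetric] simp del: count_greater_zero_iff)
  qed
  then have "{i. 2 \<le> count (q + d + d) i} = set_mset d" by blast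
  then show ?thesis
    by (simp add: largest_paired_def size_conj_partition)
qed

theorem theorem2p1:
  fixes n k :: nat
  shows "card {p \<in> partitions n. pairing_index p = int k} = card {p \<in> partitions n. size p = k}"
proof -
  let ?O = "\<lambda>m j. card {q \<in> partitions m. odd_parts q \<and> size q = j}"
  have "card {p \<in> partitions n. pairing_index p = int k} =
      card {p \<in> partitions n. largest_paired p + alt_sum p = k}"
    by (simp add: pairing_index_def unpaired_alt_sum_eq flip: of_nat_add)
  also have "\<dots> = (\<Sum>d\<in>{d \<in> paired_halves n. size (conj_partition d) \<le> k}.
      card {q \<in> partitions (n - 2 * sum_mset d).
        distinct_parts q \<and> alt_sum q = k - size (conj_partition d)})"
    by (rule card_pair_split) (simp add: largest_paired_eq alt_sum_paired)
  also have "\<dots> = (\<Sum>d\<in>{d \<in> paired_halves n. size (conj_partition d) \<le> k}.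
      ?O (n - 2 * sum_mset d) (k - size (conj_partition d)))"
    by (simp add: card_distinct_eq_odd)
  \<comment> \<open>Conjugating \<open>d\<close> keeps its sum, hence permutes
    \<open>paired_halves n\<close>, and trades its largest part for its number of parts.\<close>
  also have "\<dots> = (\<Sum>d\<in>{d \<in> paired_halves n. size d \<le> k}. ?O (n - 2 * sum_mset d) (k - size d))"
    by (rule sum.reindex_bij_witness[of _ conj_partition conj_partition])
      (auto simp: paired_halves_def conj_conj_partition sum_conj_partition zero_notin_conj)
  \<comment> \<open>Doubling the parts of \<open>d\<close> keeps their number, so the glued
    partition has \<open>size q + size d\<close> parts.\<close>
  also have "\<dots> = card {p \<in> partitions n. size p = k}"
    by (rule card_parity_split[symmetric]) simp
  finally show ?thesis .
qed

end
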